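(* For any $n,k\ge0$, $$(\mathsf{Cyc},\mathsf{Rlmip},\mathsf{Excl},\mathsf{Sfix},\mathsf{Scyc})\sim(\mathsf{Rlmip},\mathsf{Cyc},\mathsf{Excl},\mathsf{Sfix},\mathsf{Scyc})$$ over $\mathfrak{P}_{n,k}$. In particular, $\mathsf{Cyc}$ and $\mathsf{Rlmip}$ are equidistributed and have symmetric joint distribution over $\mathfrak{P}_{n,k}$, that is, $(\mathsf{Cyc},\mathsf{Rlmip})\sim(\mathsf{Rlmip},\mathsf{Cyc})$.
   Context: A partial permutation of order $n$ is an $n\times n$ $(0,1)$-matrix $\pi=(\pi_{i,j})$ with at most one $1$ in each row and each column; $\mathfrak{P}_{n,k}$ is the set of those with exactly $k$ zero rows (for $n=0$ there is only the empty matrix, lying in $\mathfrak{P}_{0,0}$). Regard $\pi$ as the partial map $i\mapsto j$ whenever $\pi_{i,j}=1$; a full cycle of $\pi$ is a (closed) cycle of this partial map, fixed points being cycles of length $1$. - $\mathsf{Cyc}(\pi)=\{i: i \text{ is the largest number in a full cycle of }\pi\}$. - $\mathsf{Rlmip}(\pi)$ is the set of $i$ such that $\pi_{i,j}=1$ for some $j$ which is a right-to-left minimum, i.e. for every column $1\le c<j$ there is a $1$ in column $c$ in some row $r<i$ (vacuous if $j=1$). - $\mathsf{Excl}(\pi)=\{j:\pi_{i,j}=1\text{ for some } i<j\}$. - $\mathsf{Sfix}(\pi)$ is the set of $i$ with $\pi_{i,i}=1$ such that the principal submatrix of $\pi$ formed by the first $i$ rows and columns is a permutation matrix. - $\mathsf{Scyc}(\pi)$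 is the set of $i$ such that $i$ is the largest number in a full cycle and the principal submatrix of $\pi$ formed by the first $i$ rows and columns is a permutation matrix. For two tuples of (set-valued) statistics, $\sim$ means equidistribution over $\mathfrak{P}_{n,k}$: every tuple of sets is attained as value by the same number of elements $\pi\in\mathfrak{P}_{n,k}$ for both tuples of statistics. *)

theory Defs
  imports Main
begin

text \<open>
  Matrices are functions of a row and a column index. Rows and columns are numbered from 1, and
  a matrix of order \<open>n\<close> vanishes outside \<open>{1..n} \<times> {1..n}\<close>, so that
  each matrix of order \<open>n\<close> is represented by exactly one function.
\<close>

type_synonym matrix01 = "nat \<Rightarrow> nat \<Rightarrow> nat"

definition partial_perm :: "nat \<Rightarrow> matrix01 \<Rightarrow> bool" where
  "partial_perm n A \<longleftrightarrow>
     (\<forall>i j. A i j \<in> {0, 1}) \<and>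
     (\<forall>i j. i \<notin> {1..n} \<or> j \<notin> {1..n} \<longrightarrow> A i j = 0) \<and>
     (\<forall>i j j'. A i j = 1 \<and> A i j' = 1 \<longrightarrow> j = j') \<and>
     (\<forall>i i' j. A i j = 1 \<and> A i' j = 1 \<longrightarrow> i = i')"

definition partial_perms :: "nat \<Rightarrow> nat \<Rightarrow> matrix01 set" where
  "partial_perms n k =
     {A. partial_perm n A \<and> card {i \<in> {1..n}. \<forall>j\<in>{1..n}. A i j = 0} = k}"

text \<open>
  The list \<open>xs\<close> enumerates a closed cycle
  \<open>xs ! 0 \<mapsto> xs ! 1 \<mapsto> \<dots> \<mapsto> xs ! 0\<close>
  of the partial map \<open>i \<mapsto> j\<close> given by \<open>A i j = 1\<close>.
\<close>

definition full_cycle :: "matrix01 \<Rightarrow> nat list \<Rightarrow> bool" where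
  "full_cycle A xs \<longleftrightarrow>
     xs \<noteq> [] \<and> distinct xs \<and>
     (\<forall>l<length xs. A (xs ! l) (xs ! (Suc l mod length xs)) = 1)"

definition leading_perm_matrix :: "matrix01 \<Rightarrow> nat \<Rightarrow> bool" where
  "leading_perm_matrix A m \<longleftrightarrow>
     (\<forall>r\<in>{1..m}. \<forall>c\<in>{1..m}. A r c \<in> {0, 1}) \<and>
     (\<forall>r\<in>{1..m}. \<exists>!c. c \<in> {1..m} \<and> A r c = 1) \<and>
     (\<forall>c\<in>{1..m}. \<exists>!r. r \<in> {1..m} \<and> A r c = 1)"

definition Cyc :: "matrix01 \<Rightarrow> nat set" where
  "Cyc A = {i. \<exists>xs. full_cycle A xs \<and> i = Max (set xs)}"

definition Rlmip :: "matrix01 \<Rightarrow> nat set" where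
  "Rlmip A = {i. \<exists>j. A i j = 1 \<and> (\<forall>c. 1 \<le> c \<and> c < j \<longrightarrow> (\<exists>r<i. A r c = 1))}"

definition Excl :: "matrix01 \<Rightarrow> nat set" where
  "Excl A = {j. \<exists>i. i < j \<and> A i j = 1}"

definition Sfix :: "matrix01 \<Rightarrow> nat set" where
  "Sfix A = {i. A i i = 1 \<and> leading_perm_matrix A i}"

definition Scyc :: "matrix01 \<Rightarrow> nat set" where
  "Scyc A = {i. (\<exists>xs. full_cycle A xs \<and> i = Max (set xs)) \<and> leading_perm_matrix A i}"

definition equidistributed_over :: "'a set \<Rightarrow> ('a \<Rightarrow> 'b) \<Rightarrow> ('a \<Rightarrow> 'b) \<Rightarrow> bool" where
  "equidistributed_over P f g \<longleftrightarrow>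
     (\<forall>t. card {x \<in> P. f x = t} = card {x \<in> P. g x = t})"

lemma finite_partial_perms: "finite (partial_perms n k)"
proof -
  let ?S = "\<lambda>A :: matrix01. {(i, j). A i j = 1}"
  have inj: "inj_on ?S (partial_perms n k)"
  proof (rule inj_onI)
    fix A B assume A: "A \<in> partial_perms n k" and B: "B \<in> partial_perms n k" and eq: "?S A = ?S B"
    have "A i j = B i j" for i j
    proof -
      have "A i j \<in> {0, 1}" "B i j \<in> {0, 1}"
        using A B unfolding partial_perms_def partial_perm_def by blast+
      moreover have "(i, j) \<in> ?S A \<longleftrightarrow> (i, j) \<in> ?S B"
        by (simp only: eq)
      then have "A i j = 1 \<longleftrightarrow> B i j = 1" by simp
      ultimately show ?thesis by (cases "A i j = 1") simp_all
    qed
    then have "\<And>i. A i = B i" by (rule ext)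
    then show "A = B" by (rule ext)
  qed
  have sub: "?S ` partial_perms n k \<subseteq> Pow ({1..n} \<times> {1..n})"
  proof (rule image_subsetI, rule PowI, rule subrelI)
    fix A i j assume A: "A \<in> partial_perms n k" and "(i, j) \<in> ?S A"
    then have "A i j \<noteq> 0" by simp
    moreover have "i \<notin> {1..n} \<or> j \<notin> {1..n} \<longrightarrow> A i j = 0"
      using A unfolding partial_perms_def partial_perm_def by blast
    ultimately show "(i, j) \<in> {1..n} \<times> {1..n}" by simp
  qed
  have "finite (Pow ({1..n} \<times> {1..n}))" by simp
  with sub have "finite (?S ` partial_perms n k)" by (rule finite_subset)
  then show ?thesis using inj by (rule finite_imageD)
qed

text \<open>All sets counted by \<^const>\<open>equidistributed_over\<close> on \<open>partial_perms n k\<close> are therefore finite.\<close>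

end

theory Submission
  imports Defs "HOL-Combinatorics.Transposition"
begin

text \<open>
  Build a partial permutation from its leading principal submatrices, adding the \<open>m\<close>-th row and
  column at once. Among the columns still empty after column \<open>m\<close> has been filled there are two
  distinguished ones: the start \<open>u\<close> of the path ending at \<open>m\<close>, and the smallest one
  \<open>l\<close>. Then \<open>m\<close> is a cycle maximum iff the entry of row \<open>m\<close> is put into column
  \<open>u\<close>, and it is a right-to-left minimum position iff it is put into column \<open>l\<close>, whereas
  \<open>m\<close> is an excedance value iff \<open>u\<close> differs from \<open>m\<close>. (Later rows and columns change
  none of this.) Transposing \<open>u\<close> and \<open>l\<close> at every step therefore exchanges the two
  statistics. Since the sets of empty rows and columns are preserved in size only, the step has to be
  transported along a bijection of the empty columns that respects the smallest one. Finally,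
  \<open>Scyc\<close> consists of the orders of the leading permutation matrices, and \<open>Sfix\<close> of those
  which are not excedance values, so both follow the number of empty rows.
\<close>

subsection \<open>Injective partial maps on a finite set\<close>

text \<open>Choosing successors gives an injective self-map of the finite set \<open>T\<close>,
  which is onto by pigeonhole. This supplies both the ends of paths and the closing edge of a
  cycle.\<close>

lemma closed_total_injective_imp_Range:
  assumes "finite T" "R `` T \<subseteq> T" "T \<subseteq> Domain R" "single_valued (R\<inverse>)" "x \<in> T"
  shows "\<exists>t\<in>T. (t, x) \<in> R"
proof -
  from assms(3) have "\<forall>t\<in>T. \<exists>y. (t, y) \<in> R" by blast
  then obtain f where f: "\<forall>t\<in>T. (t, f t) \<in> R" by metis
  have "inj_on f T"
    using f assms(4) by (intro inj_onI) (metis converse_iff single_valuedD)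
  moreover have "f ` T \<subseteq> T" using f assms(2) by blast
  ultimately have "f ` T = T" using assms(1) by (simp add: endo_inj_surj)
  then obtain t where "t \<in> T" "x = f t" using assms(5) by blast
  with f show ?thesis by blast
qed

text \<open>If every point reachable from \<open>c\<close> had a successor, the reachable set would
  be closed and total, and pigeonhole would give \<open>c\<close> a predecessor.\<close>

lemma ex_path_end:
  assumes "finite X" "R \<subseteq> X \<times> X" "single_valued (R\<inverse>)" "c \<in> X" "c \<notin> Range R"
  shows "\<exists>r. r \<in> X - Domain R \<and> (c, r) \<in> R\<^sup>*"
proof (rule ccontr)
  assume no: "\<not> ?thesis"
  let ?T = "R\<^sup>* `` {c}"
  have TX: "?T \<subseteq> X"
  proof
    fix y assume "y \<in> ?T"
    then have "(c, y) \<in> R\<^sup>*" by simp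
    then show "y \<in> X" using assms(2,4) by cases auto
  qed
  have "\<exists>t\<in>?T. (t, c) \<in> R"
  proof (rule closed_total_injective_imp_Range[OF _ _ _ assms(3)])
    show "finite ?T" using TX assms(1) finite_subset by blast
    show "R `` ?T \<subseteq> ?T" by (auto intro: rtrancl_into_rtrancl)
    show "?T \<subseteq> Domain R" using no TX by blast
  qed auto
  with assms(5) show False by blast
qed

text \<open>An injective partial map on a finite set splits into cycles and paths. The description
  is meaningful at starts of paths, an isolated point being its own end; on a cycle there is no such
  \<open>r\<close>.\<close>

definition path_end :: "('a \<times> 'a) set \<Rightarrow> 'a \<Rightarrow> 'a" where
  "path_end R c = (THE r. r \<notin> Domain R \<and> (c, r) \<in> R\<^sup>*)"

lemma path_end_eqI:
  assumes "single_valued R" "r \<notin> Domain R" "(c, r) \<in> R\<^sup>*"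
  shows "path_end R c = r"
  unfolding path_end_def
proof (rule the_equality)
  fix s assume s: "s \<notin> Domain R \<and> (c, s) \<in> R\<^sup>*"
  then have "(r, s) \<in> R\<^sup>* \<or> (s, r) \<in> R\<^sup>*"
    using single_valued_confluent assms by metis
  then show "s = r" using s assms(2) by (metis Not_Domain_rtrancl)
qed (use assms in blast)

lemma path_end:
  assumes "finite X" "R \<subseteq> X \<times> X" "single_valued R" "single_valued (R\<inverse>)"
    and "c \<in> X - Range R"
  shows "path_end R c \<in> X - Domain R" "(c, path_end R c) \<in> R\<^sup>*"
  using ex_path_end[of X R c] path_end_eqI[of R _ c] assms by auto

text \<open>Reversing \<open>R\<close> exchanges starts and ends of paths, so the inverse map is the
  path end map of \<open>R\<inverse>\<close>.\<close>

lemma bij_betw_path_end: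
  assumes "finite X" "R \<subseteq> X \<times> X" "single_valued R" "single_valued (R\<inverse>)"
  shows "bij_betw (path_end R) (X - Range R) (X - Domain R)"
  unfolding bij_betw_def
proof
  show "inj_on (path_end R) (X - Range R)"
  proof (rule inj_onI)
    fix c d assume c: "c \<in> X - Range R" and d: "d \<in> X - Range R"
      and eq: "path_end R c = path_end R d"
    have "(path_end R c, c) \<in> (R\<inverse>)\<^sup>*" "(path_end R c, d) \<in> (R\<inverse>)\<^sup>*"
      using path_end(2)[OF assms c] path_end(2)[OF assms d] eq by (simp_all add: rtrancl_converse)
    then have "path_end (R\<inverse>) (path_end R c) = c" "path_end (R\<inverse>) (path_end R c) = d"
      using c d assms(4) by (auto intro!: path_end_eqI)
    then show "c = d" by simp
  qed
  show "path_end R ` (X - Range R) = X - Domain R"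
  proof
    show "path_end R ` (X - Range R) \<subseteq> X - Domain R"
      using path_end(1)[OF assms] by blast
    show "X - Domain R \<subseteq> path_end R ` (X - Range R)"
    proof
      fix r assume r: "r \<in> X - Domain R"
      have "\<exists>c. c \<in> X - Domain (R\<inverse>) \<and> (r, c) \<in> (R\<inverse>)\<^sup>*"
        by (rule ex_path_end) (use assms r in auto)
      then obtain c where c: "c \<in> X - Range R" "(c, r) \<in> R\<^sup>*"
        by (auto simp: rtrancl_converse)
      then have "path_end R c = r" using r assms(3) by (intro path_end_eqI) auto
      with c show "r \<in> path_end R ` (X - Range R)" by blast
    qed
  qed
qed

subsection \<open>Partial permutations as relations\<close>

definition edges :: "matrix01 \<Rightarrow> (nat \<times> nat) set" where
  "edges A = {(i, j). A i j = 1}"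

definition indicator_matrix :: "(nat \<times> nat) set \<Rightarrow> matrix01" where
  "indicator_matrix R = (\<lambda>i j. of_bool ((i, j) \<in> R))"

definition empty_rows :: "nat \<Rightarrow> matrix01 \<Rightarrow> nat set" where
  "empty_rows n A = {1..n} - Domain (edges A)"

definition empty_cols :: "nat \<Rightarrow> matrix01 \<Rightarrow> nat set" where
  "empty_cols n A = {1..n} - Range (edges A)"

lemma edges_indicator_matrix [simp]: "edges (indicator_matrix R) = R"
  by (auto simp: edges_def indicator_matrix_def)

lemma partial_perm_iff:
  "partial_perm n A \<longleftrightarrow> (\<forall>i j. A i j \<in> {0, 1}) \<and> edges A \<subseteq> {1..n} \<times> {1..n} \<and>
     single_valued (edges A) \<and> single_valued ((edges A)\<inverse>)"
  (is "_ \<longleftrightarrow> ?Z \<and> ?B \<and> ?R \<and> ?C")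
proof -
  have "(\<forall>i j. i \<notin> {1..n} \<or> j \<notin> {1..n} \<longrightarrow> A i j = 0) \<longleftrightarrow> ?B" if ?Z
  proof
    assume "\<forall>i j. i \<notin> {1..n} \<or> j \<notin> {1..n} \<longrightarrow> A i j = 0"
    then have "i \<in> {1..n} \<and> j \<in> {1..n}" if "A i j = 1" for i j
      using that by (metis zero_neq_one)
    then show ?B unfolding edges_def by blast
  next
    assume B: ?B
    show "\<forall>i j. i \<notin> {1..n} \<or> j \<notin> {1..n} \<longrightarrow> A i j = 0"
    proof (intro allI impI)
      fix i j assume "i \<notin> {1..n} \<or> j \<notin> {1..n}"
      then have "(i, j) \<notin> edges A" using B by blast
      then show "A i j = 0" using that by (auto simp: edges_def)
    qed
  qed
  moreover have "(\<forall>i j j'. A i j = 1 \<and> A i j' = 1 \<longrightarrow> j = j') \<longleftrightarrow> ?R"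
    by (auto simp: single_valued_def edges_def)
  moreover have "(\<forall>i i' j. A i j = 1 \<and> A i' j = 1 \<longrightarrow> i = i') \<longleftrightarrow> ?C"
    by (auto simp: single_valued_def edges_def)
  ultimately show ?thesis unfolding partial_perm_def by blast
qed

lemma partial_perm_indicator_matrix_iff:
  "partial_perm n (indicator_matrix R) \<longleftrightarrow>
     R \<subseteq> {1..n} \<times> {1..n} \<and> single_valued R \<and> single_valued (R\<inverse>)"
proof -
  have "\<forall>i j. indicator_matrix R i j \<in> {0, 1}" by (simp add: indicator_matrix_def)
  then show ?thesis by (simp add: partial_perm_iff)
qed

lemma indicator_matrix_edges:
  assumes "partial_perm n A"
  shows "indicator_matrix (edges A) = A"
proof (intro ext)
  fix i j
  have "A i j \<in> {0, 1}" using assms by (auto simp: partial_perm_iff)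
  then show "indicator_matrix (edges A) i j = A i j"
    by (auto simp: indicator_matrix_def edges_def)
qed

lemma partial_permD:
  assumes "partial_perm n A"
  shows "edges A \<subseteq> {1..n} \<times> {1..n}" "single_valued (edges A)" "single_valued ((edges A)\<inverse>)"
  using assms by (auto simp: partial_perm_iff)

text \<open>An empty column is the start of a path and an empty row the end of one. Hence both are
  equally many, and the row that receives an entry in a new column can be named by an empty
  column.\<close>

lemma bij_betw_empty_cols_rows:
  assumes "partial_perm n A"
  shows "bij_betw (path_end (edges A)) (empty_cols n A) (empty_rows n A)"
  unfolding empty_cols_def empty_rows_def
  by (rule bij_betw_path_end) (use partial_permD[OF assms] in auto)

lemma zero_rows_eq:
  assumes "partial_perm n A"
  shows "{i \<in> {1..n}. \<forall>j\<in>{1..n}. A i j = 0} = empty_rows n A"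
proof -
  have "A i j = 0 \<longleftrightarrow> (i, j) \<notin> edges A" for i j
    using assms by (auto simp: partial_perm_iff edges_def)
  then show ?thesis using partial_permD(1)[OF assms] unfolding empty_rows_def by blast
qed

subsection \<open>The statistics depend on leading principal submatrices\<close>

text \<open>The bound excludes the order 0, for which \<open>leading_perm_matrix\<close> holds
  vacuously.\<close>

definition leading_perm_orders :: "matrix01 \<Rightarrow> nat set" where
  "leading_perm_orders A = {i. 1 \<le> i \<and> leading_perm_matrix A i}"

text \<open>The largest point of a cycle is one whose orbit returns to it without ever exceeding it.
  In this form membership of \<open>i\<close> visibly depends only on the leading block of order
  \<open>i\<close>.\<close>

lemma in_Cyc_iff: "i \<in> Cyc A \<longleftrightarrow> (i, i) \<in> (edges A \<inter> {..i} \<times> {..i})\<^sup>+"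
  (is "_ \<longleftrightarrow> _ \<in> ?R\<^sup>+")
proof
  assume "i \<in> Cyc A"
  then obtain xs where xs: "full_cycle A xs" and i: "i = Max (set xs)"
    unfolding Cyc_def by blast
  let ?n = "length xs"
  have ne: "xs \<noteq> []" using xs by (simp add: full_cycle_def)
  then obtain l where l: "l < ?n" "xs ! l = i"
    using i by (metis Max_in finite_set in_set_conv_nth set_empty)
  \<comment> \<open>Indices are read modulo the length, so the walk can start at the position
    \<open>l\<close> of \<open>i\<close> and is back there after \<open>?n\<close> steps.\<close>
  have step: "(xs ! (k mod ?n), xs ! (Suc k mod ?n)) \<in> ?R" for k
  proof -
    have "k mod ?n < ?n" "Suc k mod ?n < ?n" using ne by auto
    moreover from this have "A (xs ! (k mod ?n)) (xs ! (Suc (k mod ?n) mod ?n)) = 1"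
      using xs unfolding full_cycle_def by blast
    ultimately show ?thesis using i by (simp add: edges_def mod_Suc_eq)
  qed
  have "(xs ! (l mod ?n), xs ! (Suc (l + k) mod ?n)) \<in> ?R\<^sup>+" for k
  proof (induction k)
    case 0
    show ?case using step[of l] by auto
  next
    case (Suc k)
    then show ?case using step[of "Suc (l + k)"] trancl_into_trancl by fastforce
  qed
  from this[of "?n - 1"] show "(i, i) \<in> ?R\<^sup>+"
    using l ne by (simp add: Suc_diff_le)
next
  assume "(i, i) \<in> ?R\<^sup>+"
  then have ex: "\<exists>k. k > 0 \<and> (i, i) \<in> ?R ^^ k" by (simp add: trancl_power)
  \<comment> \<open>A shortest closed walk repeats no vertex: the piece between two visits to the
    same vertex could be cut out, leaving a shorter closed walk of positive length.\<close>
  define k where "k = (LEAST k. k > 0 \<and> (i, i) \<in> ?R ^^ k)"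
  have k: "k > 0" "(i, i) \<in> ?R ^^ k"
    using LeastI_ex[OF ex] by (auto simp: k_def)
  have least: "k \<le> l" if "l > 0" "(i, i) \<in> ?R ^^ l" for l
    unfolding k_def using that by (intro Least_le) simp
  obtain f where f: "f 0 = i" "f k = i" "\<And>l. l < k \<Longrightarrow> (f l, f (Suc l)) \<in> ?R"
    using k(2) unfolding relpow_fun_conv by blast
  have path: "(f a, f (a + d)) \<in> ?R ^^ d" if "a + d \<le> k" for a d
    using that
  proof (induction d)
    case (Suc d)
    then show ?case using f(3)[of "a + d"] by auto
  qed simp
  have inj: "f a \<noteq> f b" if "a < b" "b < k" for a b
  proof
    assume eq: "f a = f b"
    have "(i, f a) \<in> ?R ^^ a" "(f b, i) \<in> ?R ^^ (k - b)"
      using path[of 0 a] path[of b "k - b"] that f by auto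
    then have "(i, i) \<in> ?R ^^ (a + (k - b))" using eq by (auto simp: relpow_add)
    then show False using least[of "a + (k - b)"] that by simp
  qed
  let ?xs = "map f [0..<k]"
  have "distinct ?xs"
    using inj by (auto simp: distinct_map inj_on_def) (metis linorder_neqE_nat)
  moreover have "A (?xs ! l) (?xs ! (Suc l mod length ?xs)) = 1" if "l < length ?xs" for l
  proof -
    have l: "l < k" using that by simp
    have "f (Suc l mod k) = f (Suc l)"
      using l f(1,2) by (cases "Suc l = k") auto
    then show ?thesis using f(3)[OF l] l by (auto simp: edges_def)
  qed
  ultimately have "full_cycle A ?xs" using k(1) by (simp add: full_cycle_def)
  moreover have "i = Max (set ?xs)"
  proof (rule Max_eqI[symmetric])
    show "i \<in> set ?xs" using f(1) k(1) by force
    fix y assume "y \<in> set ?xs"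
    then show "y \<le> i" using f(3) by fastforce
  qed simp
  ultimately show "i \<in> Cyc A" unfolding Cyc_def by blast
qed

text \<open>The \<open>j - 1\<close> columns left of \<open>j\<close> have entries in distinct rows
  above \<open>i\<close>, which forces \<open>j \<le> i\<close>. So the entry and all its witnesses
  lie in the leading block of order \<open>i\<close>.\<close>

lemma in_Rlmip_iff:
  assumes "partial_perm n A"
  shows "i \<in> Rlmip A \<longleftrightarrow>
    (\<exists>j\<le>i. A i j = 1 \<and> (\<forall>c. 1 \<le> c \<and> c < j \<longrightarrow> (\<exists>r<i. A r c = 1)))"
proof
  assume "i \<in> Rlmip A"
  then obtain j where j: "A i j = 1" "\<forall>c. 1 \<le> c \<and> c < j \<longrightarrow> (\<exists>r<i. A r c = 1)"
    unfolding Rlmip_def by blast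
  then have "\<forall>c\<in>{1..<j}. \<exists>r<i. A r c = 1" by simp
  then obtain f where f: "\<forall>c\<in>{1..<j}. f c < i \<and> A (f c) c = 1" by metis
  have pos: "i \<ge> 1" "\<And>r c. A r c = 1 \<Longrightarrow> r \<ge> 1"
    using partial_permD(1)[OF assms] j(1) by (auto simp: edges_def)
  have "inj_on f {1..<j}"
    using f partial_permD(2)[OF assms] unfolding single_valued_def edges_def
    by (intro inj_onI) (metis (mono_tags, lifting) case_prodI mem_Collect_eq)
  moreover have "f ` {1..<j} \<subseteq> {1..<i}" using f pos by auto
  ultimately have "card {1..<j} \<le> card {1..<i}" by (intro card_inj_on_le) auto
  then have "j \<le> i" using pos by simp
  with j show "\<exists>j\<le>i. A i j = 1 \<and> (\<forall>c. 1 \<le> c \<and> c < j \<longrightarrow> (\<exists>r<i. A r c = 1))"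
    by blast
qed (auto simp: Rlmip_def)

text \<open>The orders \<open>n\<close> and \<open>m\<close> may differ, because a matrix is to be
  compared with its extension by one row and column.\<close>

lemma local_statistics:
  assumes "partial_perm n A" "partial_perm m B" "\<And>a b. a \<le> i \<Longrightarrow> b \<le> i \<Longrightarrow> A a b = B a b"
  shows "i \<in> Cyc A \<longleftrightarrow> i \<in> Cyc B" "i \<in> Rlmip A \<longleftrightarrow> i \<in> Rlmip B" "i \<in> Excl A \<longleftrightarrow> i \<in> Excl B"
    "i \<in> leading_perm_orders A \<longleftrightarrow> i \<in> leading_perm_orders B"
proof -
  have "edges A \<inter> {..i} \<times> {..i} = edges B \<inter> {..i} \<times> {..i}"
    using assms(3) by (auto simp: edges_def)
  then show "i \<in> Cyc A \<longleftrightarrow> i \<in> Cyc B" by (simp add: in_Cyc_iff)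
  show "i \<in> Rlmip A \<longleftrightarrow> i \<in> Rlmip B"
    unfolding in_Rlmip_iff[OF assms(1)] in_Rlmip_iff[OF assms(2)]
    by (auto simp: assms(3) cong: conj_cong)
  show "i \<in> Excl A \<longleftrightarrow> i \<in> Excl B"
    using assms(3) by (auto simp: Excl_def)
  show "i \<in> leading_perm_orders A \<longleftrightarrow> i \<in> leading_perm_orders B"
    using assms(3) by (simp add: leading_perm_orders_def leading_perm_matrix_def cong: conj_cong)
qed

lemma statistics_bounded:
  assumes "partial_perm n A"
  shows "Cyc A \<subseteq> {1..n}" "Rlmip A \<subseteq> {1..n}" "Excl A \<subseteq> {1..n}" "leading_perm_orders A \<subseteq> {1..n}"
proof -
  note bounds = partial_permD(1)[OF assms]
  show "Cyc A \<subseteq> {1..n}"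
  proof
    fix i assume "i \<in> Cyc A"
    then have "(i, i) \<in> (edges A \<inter> {..i} \<times> {..i})\<^sup>+" by (simp add: in_Cyc_iff)
    then show "i \<in> {1..n}" using bounds by cases auto
  qed
  show "Rlmip A \<subseteq> {1..n}" "Excl A \<subseteq> {1..n}"
    using bounds by (auto simp: Rlmip_def Excl_def edges_def)
  show "leading_perm_orders A \<subseteq> {1..n}"
  proof
    fix i assume i: "i \<in> leading_perm_orders A"
    then have "i \<in> {1..i}" by (simp add: leading_perm_orders_def)
    with i obtain j where "A i j = 1"
      unfolding leading_perm_orders_def leading_perm_matrix_def by blast
    then show "i \<in> {1..n}" using bounds by (auto simp: edges_def)
  qed
qed

text \<open>Inside a leading permutation matrix of order \<open>i\<close> the orbit of
  \<open>i\<close> stays within \<open>{1..i}\<close> and never stops, so it closes up, and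
  \<open>i\<close> is its maximum.\<close>

lemma leading_perm_orders_subset_Cyc:
  assumes "partial_perm n A"
  shows "leading_perm_orders A \<subseteq> Cyc A"
proof
  fix i assume "i \<in> leading_perm_orders A"
  then have i: "1 \<le> i" and L: "leading_perm_matrix A i" by (auto simp: leading_perm_orders_def)
  let ?R = "edges A \<inter> {..i} \<times> {..i}"
  let ?T = "?R\<^sup>* `` {i}"
  have TX: "?T \<subseteq> {1..i}"
  proof
    fix y assume "y \<in> ?T"
    then have "(i, y) \<in> ?R\<^sup>*" by simp
    then show "y \<in> {1..i}" using i partial_permD(1)[OF assms] by cases auto
  qed
  have "\<exists>t\<in>?T. (t, i) \<in> ?R"
  proof (rule closed_total_injective_imp_Range)
    show "finite ?T" using TX finite_subset by blast
    show "?R `` ?T \<subseteq> ?T" by (auto intro: rtrancl_into_rtrancl)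
    show "?T \<subseteq> Domain ?R"
    proof
      fix y assume "y \<in> ?T"
      then have y: "y \<in> {1..i}" using TX by blast
      then obtain c where "c \<in> {1..i}" "A y c = 1"
        using L unfolding leading_perm_matrix_def by blast
      then show "y \<in> Domain ?R" using y by (auto simp: edges_def)
    qed
    show "single_valued (?R\<inverse>)"
      using partial_permD(3)[OF assms] unfolding single_valued_def by blast
  qed auto
  then show "i \<in> Cyc A" unfolding in_Cyc_iff by (auto intro: rtrancl_into_trancl1)
qed

lemma Scyc_eq:
  assumes "partial_perm n A"
  shows "Scyc A = leading_perm_orders A"
proof -
  have "Scyc A = {i \<in> Cyc A. leading_perm_matrix A i}" by (auto simp: Scyc_def Cyc_def)
  then show ?thesis
    using leading_perm_orders_subset_Cyc[OF assms] statistics_bounded(1)[OF assms]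
    by (auto simp: leading_perm_orders_def)
qed

text \<open>Column \<open>i\<close> of a leading permutation matrix of order \<open>i\<close> has
  its entry in a row at most \<open>i\<close>; without an entry above the diagonal only the diagonal
  remains. Conversely, a diagonal entry leaves no room for an excedance in its column.\<close>

lemma Sfix_eq:
  assumes "partial_perm n A"
  shows "Sfix A = leading_perm_orders A - Excl A"
proof (rule set_eqI)
  fix i
  show "i \<in> Sfix A \<longleftrightarrow> i \<in> leading_perm_orders A - Excl A"
  proof
    assume "i \<in> Sfix A"
    then have i: "A i i = 1" "leading_perm_matrix A i" by (auto simp: Sfix_def)
    then have "(i, i) \<in> edges A" by (simp add: edges_def)
    moreover from this have "1 \<le> i" using partial_permD(1)[OF assms] by auto
    moreover have "i \<notin> Excl A"
      using \<open>(i, i) \<in> edges A\<close> partial_permD(3)[OF assms]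
      by (auto simp: Excl_def edges_def single_valued_def)
    ultimately show "i \<in> leading_perm_orders A - Excl A"
      using i by (simp add: leading_perm_orders_def)
  next
    assume i: "i \<in> leading_perm_orders A - Excl A"
    then have i': "i \<in> {1..i}" "leading_perm_matrix A i" by (auto simp: leading_perm_orders_def)
    then have "\<exists>!r. r \<in> {1..i} \<and> A r i = 1" unfolding leading_perm_matrix_def by fast
    then obtain r where r: "r \<in> {1..i}" "A r i = 1" by blast
    moreover have "\<not> r < i" using i r(2) unfolding Excl_def by blast
    then have "r = i" using r(1) by simp
    ultimately show "i \<in> Sfix A" using i' by (simp add: Sfix_def)
  qed
qed

text \<open>If no row is empty then no column is, by the path bijection. The number of empty rows
  thus decides whether the whole matrix is a permutation matrix.\<close>

lemma leading_perm_matrix_iff_empty_rows: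
  assumes "partial_perm n A"
  shows "leading_perm_matrix A n \<longleftrightarrow> empty_rows n A = {}"
proof
  assume "leading_perm_matrix A n"
  then have "\<exists>c. A r c = 1" if "r \<in> {1..n}" for r
    using that unfolding leading_perm_matrix_def by blast
  then show "empty_rows n A = {}"
    unfolding empty_rows_def edges_def by auto
next
  note D = partial_permD[OF assms]
  have edge: "(r, c) \<in> edges A \<longleftrightarrow> A r c = 1" for r c by (simp add: edges_def)
  assume r: "empty_rows n A = {}"
  then have c: "empty_cols n A = {}"
    using bij_betw_empty_cols_rows[OF assms] by (simp add: bij_betw_def)
  show "leading_perm_matrix A n"
    unfolding leading_perm_matrix_def edge[symmetric]
  proof (intro conjI ballI)
    show "A r c \<in> {0, 1}" for r c using assms unfolding partial_perm_def by blast
  next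
    fix i assume "i \<in> {1..n}"
    then obtain j where j: "(i, j) \<in> edges A" using r unfolding empty_rows_def by blast
    show "\<exists>!j. j \<in> {1..n} \<and> (i, j) \<in> edges A"
    proof (rule ex1I)
      show "j \<in> {1..n} \<and> (i, j) \<in> edges A" using j D(1) by blast
    qed (use j single_valuedD[OF D(2)] in blast)
  next
    fix j assume "j \<in> {1..n}"
    then obtain i where i: "(i, j) \<in> edges A" using c unfolding empty_cols_def by blast
    show "\<exists>!i. i \<in> {1..n} \<and> (i, j) \<in> edges A"
    proof (rule ex1I)
      show "i \<in> {1..n} \<and> (i, j) \<in> edges A" using i D(1) by blast
    qed (use i single_valuedD[OF D(3)] in blast)
  qed
qed


subsection \<open>Adding a last row and column\<close>

definition choices :: "nat \<Rightarrow> nat set \<Rightarrow> (nat \<times> nat option) set" where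
  "choices m X = {(u, c). u \<in> insert m X \<and>
     (\<forall>j. c = Some j \<longrightarrow> j \<in> insert m X \<and> (j = m \<longrightarrow> u = m))}"

text \<open>
  Once column \<open>m = Suc n\<close> has been filled, \<open>u\<close> is the start of the path ending at
  \<open>m\<close>, so \<open>u = m\<close> encodes a column \<open>m\<close> without an entry above the diagonal;
  \<open>c\<close> is the column of the entry of row \<open>m\<close>, if there is one. Choosing \<open>c = Some m\<close>
  requires column \<open>m\<close> to be still empty.
\<close>

definition extend :: "nat \<Rightarrow> matrix01 \<Rightarrow> nat \<times> nat option \<Rightarrow> matrix01" where
  "extend n A = (\<lambda>(u, c). indicator_matrix (edges A
     \<union> (if u = Suc n then {} else {(path_end (edges A) u, Suc n)}) \<union> {Suc n} \<times> set_option c))"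

lemma edges_extend:
  "edges (extend n A (u, c)) = edges A
     \<union> (if u = Suc n then {} else {(path_end (edges A) u, Suc n)}) \<union> {Suc n} \<times> set_option c"
  by (simp add: extend_def)

section \<open>Effect of one extension step on edges, empty rows and statistics\<close>

context
  fixes n m :: nat and A B :: matrix01 and u :: nat and c :: "nat option"
  assumes A: "partial_perm n A" and m: "m = Suc n"
    and uc: "(u, c) \<in> choices m (empty_cols n A)" and B: "B = extend n A (u, c)"
begin

private lemma u_cases:
  obtains "u = m" | "u \<noteq> m" "u \<in> empty_cols n A" "path_end (edges A) u \<in> empty_rows n A"
  using uc bij_betw_apply[OF bij_betw_empty_cols_rows[OF A]] unfolding choices_def by blast

private lemma c_cases:
  obtains "c = None" | "c = Some m" "u = m" | j where "c = Some j" "j \<noteq> m" "j \<in> empty_cols n A"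
  using uc unfolding choices_def by (cases c) auto

private lemma edges_B:
  "edges B = edges A \<union> (if u = m then {} else {(path_end (edges A) u, m)}) \<union> {m} \<times> set_option c"
  unfolding B m by (rule edges_extend)

private lemma old_edges: "edges A \<subseteq> {1..n} \<times> {1..n}"
  by (rule partial_permD(1)[OF A])

private lemma path_end_old: "u \<noteq> m \<Longrightarrow> path_end (edges A) u \<in> {1..n}"
  by (rule u_cases) (auto simp: empty_rows_def)

lemma partial_perm_extend: "partial_perm m B"
proof -
  note D = partial_permD(2,3)[OF A]
  have "edges B \<subseteq> {1..m} \<times> {1..m} \<and> single_valued (edges B) \<and> single_valued ((edges B)\<inverse>)"
    unfolding edges_B
    by (rule u_cases; rule c_cases)
      (use old_edges D in \<open>auto simp: m single_valued_def empty_cols_def empty_rows_def\<close>)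
  then show ?thesis
    using partial_perm_indicator_matrix_iff[of m "edges B"] by (simp add: B extend_def split: if_splits)
qed

lemma old_edges_extend: "edges B \<inter> {..n} \<times> {..n} = edges A"
  unfolding edges_B using old_edges by (auto simp: m)

private lemma old_edge_iff: "i \<le> n \<Longrightarrow> j \<le> n \<Longrightarrow> (i, j) \<in> edges B \<longleftrightarrow> (i, j) \<in> edges A"
  unfolding old_edges_extend[symmetric] by simp

lemma last_row_extend: "(m, j) \<in> edges B \<longleftrightarrow> c = Some j"
proof -
  show ?thesis unfolding edges_B using old_edges path_end_old by (auto simp: m)
qed

lemma last_col_extend: "i \<le> n \<Longrightarrow> (i, m) \<in> edges B \<longleftrightarrow> u \<noteq> m \<and> i = path_end (edges A) u"
  unfolding edges_B using old_edges by (auto simp: m)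

lemma empty_rows_extend:
  "empty_rows m B = empty_rows n A - (if u = m then {} else {path_end (edges A) u})
     \<union> (if c = None then {m} else {})"
proof -
  have "{1..m} = insert m {1..n}" by (auto simp: m)
  then show ?thesis
    unfolding empty_rows_def edges_B using old_edges path_end_old by (auto simp: m)
qed

text \<open>The choice enters only through the tests \<open>u \<noteq> m\<close> and
  \<open>c = None\<close>, both invariant under the exchange below. The subtraction does not
  truncate: if \<open>u \<noteq> m\<close>, the end of the path from \<open>u\<close> is an empty
  row of \<open>A\<close>.\<close>

lemma card_empty_rows_extend:
  "card (empty_rows m B) = card (empty_rows n A) - of_bool (u \<noteq> m) + of_bool (c = None)"
proof -
  have fin: "finite (empty_rows n A)" and nin: "m \<notin> empty_rows n A"
    by (auto simp: empty_rows_def m)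
  show ?thesis
    by (rule u_cases) (use fin nin in \<open>auto simp: empty_rows_extend card_Diff_singleton\<close>)
qed

private lemma agree: "i \<le> n \<Longrightarrow> j \<le> n \<Longrightarrow> B i j = A i j"
proof -
  assume "i \<le> n" "j \<le> n"
  then have "(i, j) \<in> edges B \<longleftrightarrow> (i, j) \<in> edges A" by (rule old_edge_iff)
  then have "indicator_matrix (edges B) i j = indicator_matrix (edges A) i j"
    by (simp add: indicator_matrix_def)
  then show "B i j = A i j"
    by (simp only: indicator_matrix_edges[OF A] indicator_matrix_edges[OF partial_perm_extend])
qed

text \<open>A cycle through \<open>m\<close> leaves it for the column given by \<open>c\<close> and,
  unless it is a loop, returns through the end of the path starting at \<open>u\<close>. An end
  determines the start of its path, so the column entered is \<open>u\<close>; a loop is the case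
  \<open>u = m\<close>.\<close>

lemma last_in_Cyc_extend: "m \<in> Cyc B \<longleftrightarrow> c = Some u"
proof -
  have "edges B \<inter> {..m} \<times> {..m} = edges B"
    using partial_permD(1)[OF partial_perm_extend] by auto
  then have cyc: "m \<in> Cyc B \<longleftrightarrow> (m, m) \<in> (edges B)\<^sup>+" by (simp add: in_Cyc_iff)
  \<comment> \<open>Cutting a walk at its first visit to \<open>m\<close> leaves a walk inside
    \<open>edges A\<close> followed by one edge into \<open>m\<close>.\<close>
  have hit: "\<exists>r\<le>n. (x, r) \<in> (edges A)\<^sup>* \<and> (r, m) \<in> edges B"
    if "(x, m) \<in> (edges B)\<^sup>*" "x \<noteq> m" for x
    using that
  proof (induction rule: converse_rtrancl_induct)
    case (step x y)
    then have "x \<in> {1..m}" using partial_permD(1)[OF partial_perm_extend] by blast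
    with step.prems have x: "x \<le> n" by (auto simp: m)
    show ?case
    proof (cases "y = m")
      case True
      then show ?thesis using step.hyps(1) x by (intro exI[of _ x]) simp
    next
      case False
      have "y \<in> {1..m}" using step.hyps partial_permD(1)[OF partial_perm_extend] by blast
      then have "y \<le> n" using False by (auto simp: m)
      then have "(x, y) \<in> edges A" using step.hyps(1) old_edge_iff[OF x] by simp
      with step.IH[OF False] show ?thesis by (meson converse_rtrancl_into_rtrancl)
    qed
  qed simp
  show ?thesis
  proof (rule c_cases)
    assume "c = None"
    then have "m \<notin> Domain (edges B)" using last_row_extend by auto
    then show ?thesis using cyc \<open>c = None\<close> by (metis DomainI option.distinct(1) tranclD)
  next
    assume c: "c = Some m" "u = m"
    then have "(m, m) \<in> edges B" using last_row_extend by simp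
    then show ?thesis using c cyc by auto
  next
    fix j assume j: "c = Some j" "j \<noteq> m" "j \<in> empty_cols n A"
    have row: "(m, j) \<in> edges B" using last_row_extend j(1) by simp
    have path: "(j, path_end (edges A) j) \<in> (edges A)\<^sup>*"
      by (rule path_end(2)[of "{1..n}"]) (use partial_permD[OF A] j(3) in \<open>auto simp: empty_cols_def\<close>)
    have "(m, m) \<in> (edges B)\<^sup>+ \<longleftrightarrow> j = u"
    proof
      assume "(m, m) \<in> (edges B)\<^sup>+"
      then obtain y where "(m, y) \<in> edges B" "(y, m) \<in> (edges B)\<^sup>*" by (meson tranclD)
      then have "(j, m) \<in> (edges B)\<^sup>*" using last_row_extend j(1) by auto
      then obtain r where r: "r \<le> n" "(j, r) \<in> (edges A)\<^sup>*" "(r, m) \<in> edges B"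
        using hit j(2) by blast
      then have u: "u \<noteq> m" "r = path_end (edges A) u" using last_col_extend by auto
      then have u': "u \<in> empty_cols n A" "r \<notin> Domain (edges A)"
        using u_cases by (auto simp: empty_rows_def)
      then have "path_end (edges A) j = path_end (edges A) u"
        using path_end_eqI[OF partial_permD(2)[OF A] _ r(2)] u(2) by simp
      then show "j = u"
        using bij_betw_empty_cols_rows[OF A] j(3) u'(1) by (auto simp: bij_betw_def inj_on_def)
    next
      assume "j = u"
      then have "path_end (edges A) u \<le> n"
        using bij_betw_apply[OF bij_betw_empty_cols_rows[OF A] j(3)] by (auto simp: empty_rows_def)
      then have "(path_end (edges A) u, m) \<in> edges B" using last_col_extend j(2) \<open>j = u\<close> by simp
      moreover have "edges A \<subseteq> edges B" by (auto simp: edges_B)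
      then have "(u, path_end (edges A) u) \<in> (edges B)\<^sup>*"
        using path \<open>j = u\<close> rtrancl_mono by blast
      ultimately show "(m, m) \<in> (edges B)\<^sup>+" using row \<open>j = u\<close>
        by (meson rtrancl_into_rtrancl rtrancl_into_trancl2)
    qed
    then show ?thesis using cyc j(1) by simp
  qed
qed

text \<open>The columns left of \<open>j\<close> are all filled above row \<open>m\<close> exactly
  when no old empty column is smaller than \<open>j\<close>. Since \<open>m\<close> exceeds all old
  columns, it is the minimum only if none of them is empty.\<close>

lemma last_in_Rlmip_extend:
  "m \<in> Rlmip B \<longleftrightarrow> c = Some (Min (insert m (empty_cols n A)))"
proof -
  have fin: "finite (empty_cols n A)" by (simp add: empty_cols_def)
  have "m \<in> Rlmip B \<longleftrightarrow>
      (\<exists>j. c = Some j \<and> (\<forall>d. 1 \<le> d \<and> d < j \<longrightarrow> (\<exists>r<m. (r, d) \<in> edges B)))"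
    unfolding Rlmip_def using last_row_extend by (simp add: edges_def)
  also have "\<dots> \<longleftrightarrow> (\<exists>j. c = Some j \<and> (\<forall>d\<in>empty_cols n A. j \<le> d))"
  proof (intro ex_cong1 conj_cong refl)
    fix j assume "c = Some j"
    then have j: "j \<in> insert m (empty_cols n A)" using uc by (simp add: choices_def)
    then have jm: "j \<le> m" by (auto simp: empty_cols_def m)
    have "(\<exists>r<m. (r, d) \<in> edges B) \<longleftrightarrow> d \<notin> empty_cols n A" if "1 \<le> d" "d < j" for d
    proof -
      have "d \<le> n" using that jm by (simp add: m)
      then have "(r, d) \<in> edges B \<longleftrightarrow> (r, d) \<in> edges A" if "r < m" for r
        using that old_edge_iff by (simp add: m)
      moreover have "r < m" if "(r, d) \<in> edges A" for r using that old_edges by (auto simp: m)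
      ultimately have "(\<exists>r<m. (r, d) \<in> edges B) \<longleftrightarrow> (\<exists>r. (r, d) \<in> edges A)" by blast
      then show ?thesis using that \<open>d \<le> n\<close> by (auto simp: empty_cols_def)
    qed
    moreover have "1 \<le> d" if "d \<in> empty_cols n A" for d using that by (simp add: empty_cols_def)
    ultimately show "(\<forall>d. 1 \<le> d \<and> d < j \<longrightarrow> (\<exists>r<m. (r, d) \<in> edges B)) \<longleftrightarrow>
        (\<forall>d\<in>empty_cols n A. j \<le> d)"
      by (meson linorder_not_less)
  qed
  also have "\<dots> \<longleftrightarrow> c = Some (Min (insert m (empty_cols n A)))"
  proof
    assume "\<exists>j. c = Some j \<and> (\<forall>d\<in>empty_cols n A. j \<le> d)"
    then obtain j where j: "c = Some j" "\<forall>d\<in>empty_cols n A. j \<le> d" by blast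
    then have "j \<in> insert m (empty_cols n A)" using uc by (simp add: choices_def)
    moreover from this have "j \<le> m" by (auto simp: empty_cols_def m)
    ultimately have "Min (insert m (empty_cols n A)) = j"
      using j(2) fin by (intro Min_eqI) auto
    with j(1) show "c = Some (Min (insert m (empty_cols n A)))" by simp
  qed (use fin in auto)
  finally show ?thesis .
qed

lemma last_in_Excl_extend: "m \<in> Excl B \<longleftrightarrow> u \<noteq> m"
proof -
  have "(\<exists>i\<le>n. (i, m) \<in> edges B) \<longleftrightarrow> u \<noteq> m"
    using last_col_extend path_end_old by auto
  then show ?thesis by (auto simp: Excl_def edges_def m less_Suc_eq_le)
qed

lemma statistics_extend:
  "Cyc B = Cyc A \<union> (if c = Some u then {m} else {})"
  "Rlmip B = Rlmip A \<union> (if c = Some (Min (insert m (empty_cols n A))) then {m} else {})"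
  "Excl B = Excl A \<union> (if u = m then {} else {m})"
  "leading_perm_orders B = leading_perm_orders A \<union> (if card (empty_rows m B) = 0 then {m} else {})"
proof -
  \<comment> \<open>Locality settles the indices up to \<open>n\<close> and the bounds exclude those
    beyond \<open>m\<close>, so only \<open>m\<close> itself has to be decided.\<close>
  have split: "S = T \<union> (if P then {m} else {})"
    if "S \<subseteq> {1..m}" "T \<subseteq> {1..n}" "\<And>i. i \<le> n \<Longrightarrow> i \<in> S \<longleftrightarrow> i \<in> T" "m \<in> S \<longleftrightarrow> P" for S T P
  proof (rule set_eqI)
    fix i
    consider "i \<le> n" | "i = m" | "i > m" using m by linarith
    then show "i \<in> S \<longleftrightarrow> i \<in> T \<union> (if P then {m} else {})"
    proof cases
      case 1
      then show ?thesis using that(3) m by auto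
    next
      case 2
      then show ?thesis using that(2,4) m by auto
    next
      case 3
      then show ?thesis using that(1,2) m by auto
    qed
  qed
  note SB = statistics_bounded[OF partial_perm_extend] and SA = statistics_bounded[OF A]
  have loc: "i \<in> Cyc B \<longleftrightarrow> i \<in> Cyc A" "i \<in> Rlmip B \<longleftrightarrow> i \<in> Rlmip A" "i \<in> Excl B \<longleftrightarrow> i \<in> Excl A"
    "i \<in> leading_perm_orders B \<longleftrightarrow> i \<in> leading_perm_orders A" if "i \<le> n" for i
    using local_statistics[OF partial_perm_extend A, of i] agree that by auto
  show "Cyc B = Cyc A \<union> (if c = Some u then {m} else {})"
    by (rule split[OF SB(1) SA(1) loc(1) last_in_Cyc_extend])
  show "Rlmip B = Rlmip A \<union> (if c = Some (Min (insert m (empty_cols n A))) then {m} else {})"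
    by (rule split[OF SB(2) SA(2) loc(2) last_in_Rlmip_extend])
  show "Excl B = Excl A \<union> (if u = m then {} else {m})"
    using split[OF SB(3) SA(3) loc(3) last_in_Excl_extend] by simp
  have last: "m \<in> leading_perm_orders B \<longleftrightarrow> card (empty_rows m B) = 0"
    using leading_perm_matrix_iff_empty_rows[OF partial_perm_extend]
    by (auto simp: leading_perm_orders_def m empty_rows_def)
  show "leading_perm_orders B =
      leading_perm_orders A \<union> (if card (empty_rows m B) = 0 then {m} else {})"
    by (rule split[OF SB(4) SA(4) loc(4) last])
qed

end

section \<open>Unique decomposition into a leading block and a choice\<close>

definition extensions :: "nat \<Rightarrow> (matrix01 \<times> nat \<times> nat option) set" where
  "extensions n = (SIGMA A:Collect (partial_perm n). choices (Suc n) (empty_cols n A))"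

text \<open>The leading block of order \<open>n\<close> recovers \<open>A\<close>, the last row
  recovers \<open>c\<close>, and the row of an entry above the diagonal in the last column recovers
  \<open>u\<close> as the start of the path ending there.\<close>

lemma bij_betw_extend:
  "bij_betw (\<lambda>(A, uc). extend n A uc) (extensions n) (Collect (partial_perm (Suc n)))"
  unfolding bij_betw_def
proof
  show "inj_on (\<lambda>(A, uc). extend n A uc) (extensions n)"
  proof (rule inj_onI)
    fix x x'
    assume "x \<in> extensions n" "x' \<in> extensions n"
      and "(case x of (A, uc) \<Rightarrow> extend n A uc) = (case x' of (A, uc) \<Rightarrow> extend n A uc)"
    moreover obtain A u c A' u' c' where x: "x = (A, u, c)" and x': "x' = (A', u', c')"
      by (metis prod_cases3)
    ultimately have A: "partial_perm n A" "(u, c) \<in> choices (Suc n) (empty_cols n A)"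
      and A': "partial_perm n A'" "(u', c') \<in> choices (Suc n) (empty_cols n A')"
      and eq: "extend n A (u, c) = extend n A' (u', c')"
      by (auto simp: extensions_def)
    note A = A(1) refl A(2) refl and A' = A'(1) refl A'(2) eq
    have "edges A = edges A'"
      using trans[OF old_edges_extend[OF A, symmetric] old_edges_extend[OF A']] .
    then have AA: "A = A'"
      using indicator_matrix_edges[OF A(1)] indicator_matrix_edges[OF A'(1)] by metis
    have "c = Some j \<longleftrightarrow> c' = Some j" for j
      using last_row_extend[OF A] last_row_extend[OF A'] by simp
    then have cc: "c = c'" by (metis not_Some_eq)
    have uu: "u \<noteq> Suc n \<and> i = path_end (edges A) u \<longleftrightarrow> u' \<noteq> Suc n \<and> i = path_end (edges A) u'"
      if "i \<le> n" for i
      using trans[OF last_col_extend[OF A that, symmetric] last_col_extend[OF A' that]]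
      by (simp only: AA)
    note bij = bij_betw_empty_cols_rows[OF A(1)]
    have old: "v \<in> empty_cols n A \<and> path_end (edges A) v \<le> n"
      if "v \<noteq> Suc n" "v = u \<or> v = u'" for v
    proof -
      have v: "v \<in> empty_cols n A" using that A(3) A'(3) AA by (auto simp: choices_def)
      then show ?thesis using bij_betw_apply[OF bij v] by (auto simp: empty_rows_def)
    qed
    have "u = u'"
    proof (cases "u = Suc n")
      case True
      then show ?thesis using uu old[of u'] by blast
    next
      case False
      then have "u' \<noteq> Suc n" "path_end (edges A) u = path_end (edges A) u'"
        using uu old[of u] by blast+
      then show ?thesis
        using old[of u] old[of u'] False bij by (auto simp: bij_betw_def inj_on_def)
    qed
    with AA cc show "x = x'" by (simp add: x x')
  qed
  show "(\<lambda>(A, uc). extend n A uc) ` extensions n = Collect (partial_perm (Suc n))"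
  proof
    show "(\<lambda>(A, uc). extend n A uc) ` extensions n \<subseteq> Collect (partial_perm (Suc n))"
      using partial_perm_extend[OF _ refl _ refl] by (auto simp: extensions_def)
    show "Collect (partial_perm (Suc n)) \<subseteq> (\<lambda>(A, uc). extend n A uc) ` extensions n"
    proof
      fix B assume "B \<in> Collect (partial_perm (Suc n))"
      then have B: "partial_perm (Suc n) B" by simp
      note D = partial_permD[OF B]
      define R where "R = edges B \<inter> {..n} \<times> {..n}"
      define A where "A = indicator_matrix R"
      have eA: "edges A = R" by (simp add: A_def)
      have "R \<subseteq> {1..n} \<times> {1..n}" using D(1) by (auto simp: R_def)
      moreover have "single_valued R" "single_valued (R\<inverse>)"
        using single_valued_subset[OF _ D(2)] single_valued_subset[OF _ D(3)] by (auto simp: R_def)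
      ultimately have A: "partial_perm n A" by (simp add: A_def partial_perm_indicator_matrix_iff)
      note bij = bij_betw_empty_cols_rows[OF A]
      obtain c where c: "\<And>j. (Suc n, j) \<in> edges B \<longleftrightarrow> c = Some j"
      proof (cases "\<exists>j. (Suc n, j) \<in> edges B")
        case True
        then obtain j where "(Suc n, j) \<in> edges B" by blast
        then show ?thesis using that[of "Some j"] single_valuedD[OF D(2)] by auto
      next
        case False
        then show ?thesis using that[of None] by auto
      qed
      obtain u where u: "u \<in> insert (Suc n) (empty_cols n A)"
        "\<And>i. i \<le> n \<Longrightarrow> (i, Suc n) \<in> edges B \<longleftrightarrow> u \<noteq> Suc n \<and> i = path_end (edges A) u"
      proof (cases "\<exists>i\<le>n. (i, Suc n) \<in> edges B")
        case True
        then obtain r where r: "r \<le> n" "(r, Suc n) \<in> edges B" by blast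
        have "j = Suc n" if "(r, j) \<in> edges B" for j
          using single_valuedD[OF D(2) that r(2)] .
        then have "r \<notin> Domain R" by (fastforce simp: R_def)
        moreover have "r \<in> {1..n}" using r D(1) by auto
        ultimately have "r \<in> empty_rows n A" by (simp add: empty_rows_def eA)
        \<comment> \<open>Path ends exhaust the empty rows of the leading block, so the row
          \<open>r\<close> of the entry in the last column belongs to some start
          \<open>u\<close>.\<close>
        then have "r \<in> path_end (edges A) ` empty_cols n A"
          using bij by (simp add: bij_betw_def)
        then obtain u where u: "u \<in> empty_cols n A" "path_end (edges A) u = r" by blast
        moreover have "u \<noteq> Suc n" using u(1) by (auto simp: empty_cols_def)
        moreover have "i = r" if "(i, Suc n) \<in> edges B" for i
          using that r(2) D(3) by (auto simp: single_valued_def)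
        ultimately show ?thesis using that[of u] r(2) by blast
      next
        case False
        then show ?thesis using that[of "Suc n"] by blast
      qed
      have uc: "(u, c) \<in> choices (Suc n) (empty_cols n A)"
      proof -
        have "j \<in> insert (Suc n) (empty_cols n A)" "j = Suc n \<longrightarrow> u = Suc n" if "c = Some j" for j
        proof -
          have j: "(Suc n, j) \<in> edges B" using c that by simp
          then have un: "i = Suc n" if "(i, j) \<in> edges B" for i
            using that D(3) by (auto simp: single_valued_def)
          have "j \<in> {1..Suc n}" using j D(1) by blast
          then show "j \<in> insert (Suc n) (empty_cols n A)"
            using un by (fastforce simp: empty_cols_def eA R_def)
          \<comment> \<open>A diagonal entry occupies the last column, so nothing stands above it,
            which is what \<open>u = Suc n\<close> encodes.\<close>
          show "j = Suc n \<longrightarrow> u = Suc n"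
          proof (intro impI, rule ccontr)
            assume "j = Suc n" "u \<noteq> Suc n"
            then have "path_end (edges A) u \<in> empty_rows n A"
              using u(1) bij_betw_apply[OF bij] by blast
            then have "path_end (edges A) u \<le> n" by (simp add: empty_rows_def)
            with u(2) un \<open>j = Suc n\<close> \<open>u \<noteq> Suc n\<close> show False by (metis Suc_n_not_le_n)
          qed
        qed
        then show ?thesis using u(1) by (simp add: choices_def)
      qed
      have "edges (extend n A (u, c)) = edges B"
      proof (rule set_eqI, clarify)
        fix i j
        note E = A refl uc refl
        consider "i \<le> n" "j \<le> n" | "i = Suc n" | "i \<le> n" "j = Suc n"
          | "\<not> (i \<le> Suc n \<and> j \<le> Suc n)" by linarith
        then show "(i, j) \<in> edges (extend n A (u, c)) \<longleftrightarrow> (i, j) \<in> edges B"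
        proof cases
          case 1
          then show ?thesis using old_edges_extend[OF E] by (auto simp: eA R_def)
        next
          case 2
          then show ?thesis using last_row_extend[OF E] c by simp
        next
          case 3
          then show ?thesis using last_col_extend[OF E] u(2) by simp
        next
          case 4
          then show ?thesis using partial_permD(1)[OF partial_perm_extend[OF E]] D(1) by auto
        qed
      qed
      then have "extend n A (u, c) = B"
        using indicator_matrix_edges[OF B] indicator_matrix_edges[OF partial_perm_extend[OF A refl uc refl]]
        by simp
      moreover have "(A, u, c) \<in> extensions n" using A uc by (simp add: extensions_def)
      ultimately show "B \<in> (\<lambda>(A, uc). extend n A uc) ` extensions n" by force
    qed
  qed
qed

subsection \<open>Exchanging the two statistics\<close>

text \<open>If \<open>X\<close> is empty, \<open>m\<close> is itself the minimum. Otherwise any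
  bijection from \<open>X\<close> to \<open>Y\<close> is corrected by a transposition to match the
  minima and then extended by \<open>m\<close>.\<close>

lemma ex_bij_betw_Min_last:
  fixes X Y :: "nat set"
  assumes "finite X" "finite Y" "card X = card Y" "\<forall>x\<in>X \<union> Y. x < m"
  shows "\<exists>\<beta>. bij_betw \<beta> (insert m X) (insert m Y) \<and> \<beta> m = m \<and>
    \<beta> (Min (insert m X)) = Min (insert m Y)"
proof (cases "X = {}")
  case True
  then have "Y = {}" using assms by auto
  with True show ?thesis by (intro exI[of _ id]) auto
next
  case False
  then have Y: "Y \<noteq> {}" using assms by auto
  have MX: "Min (insert m X) = Min X" "Min X \<in> X" and MY: "Min (insert m Y) = Min Y" "Min Y \<in> Y"
    using False Y assms by (auto simp: Min_insert min_def not_le[symmetric])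
  obtain f where f: "bij_betw f X Y"
    using finite_same_card_bij assms by blast
  define g where "g = transpose (f (Min X)) (Min Y) \<circ> f"
  have fX: "f (Min X) \<in> Y" using f MX(2) by (auto simp: bij_betw_def)
  have "transpose (f (Min X)) (Min Y) ` Y = Y"
    using fX MY(2) by (simp add: transpose_image_eq)
  then have "bij_betw (transpose (f (Min X)) (Min Y)) Y Y"
    by (simp add: bij_betw_def inj_on_subset[OF inj_transpose])
  then have g: "bij_betw g X Y" "g (Min X) = Min Y"
    unfolding g_def using f by (auto intro: bij_betw_trans)
  define h where "h = g(m := m)"
  have h: "bij_betw h X Y"
    using g(1) assms(4) by (subst bij_betw_cong[of X h g]) (auto simp: h_def)
  have "bij_betw h (X \<union> {m}) (Y \<union> {m})"
    by (rule bij_betw_combine[OF h]) (use assms(4) in \<open>auto simp: h_def\<close>)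
  moreover have "h (Min X) = Min Y" using g(2) MX(2) assms(4) by (auto simp: h_def)
  ultimately show ?thesis using MX MY by (intro exI[of _ h]) (auto simp: h_def)
qed

text \<open>With \<open>l\<close> the least available column on the target side, choosing
  \<open>\<beta> u\<close> closes a cycle and choosing \<open>l\<close> makes a right-to-left
  minimum; the transposition swaps these after relabelling. The start \<open>u\<close> is only
  relabelled, which keeps excedance values.\<close>

definition exchange :: "nat \<Rightarrow> (nat \<Rightarrow> nat) \<Rightarrow> nat \<times> nat option \<Rightarrow> nat \<times> nat option" where
  "exchange l \<beta> = (\<lambda>(u, c). (\<beta> u, map_option (\<lambda>j. transpose l (\<beta> u) (\<beta> j)) c))"

lemma exchange:
  assumes \<beta>: "bij_betw \<beta> (insert m X) (insert m Y)" "\<beta> m = m"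
    and "\<beta> (Min (insert m X)) = Min (insert m Y)"
    and "finite X" "finite Y" "\<forall>y\<in>Y. y < m"
  defines "l \<equiv> Min (insert m Y)"
  shows "inj_on (exchange l \<beta>) (choices m X)"
    and "(u, c) \<in> choices m X \<Longrightarrow> exchange l \<beta> (u, c) \<in> choices m Y"
    and "(u, c) \<in> choices m X \<Longrightarrow> exchange l \<beta> (u, c) = (v, d) \<Longrightarrow>
      (v = m \<longleftrightarrow> u = m) \<and> (d = None \<longleftrightarrow> c = None) \<and> (d = Some v \<longleftrightarrow> c = Some (Min (insert m X))) \<and>
      (d = Some l \<longleftrightarrow> c = Some u)"
proof -
  have inj: "\<beta> x = \<beta> y \<longleftrightarrow> x = y" if "x \<in> insert m X" "y \<in> insert m X" for x y
    using \<beta>(1) that by (auto simp: bij_betw_def inj_on_def)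
  have into: "\<beta> x \<in> insert m Y" if "x \<in> insert m X" for x
    using \<beta>(1) that by (rule bij_betw_apply)
  have l: "l \<in> insert m Y" "\<beta> (Min (insert m X)) = l" "Min (insert m X) \<in> insert m X"
    using assms(3-5) Min_in[of "insert m X"] Min_in[of "insert m Y"] by (auto simp: l_def)
  \<comment> \<open>The diagonal column may be chosen only with start \<open>m\<close>. The
    transposition can send \<open>\<beta> u\<close> to \<open>m\<close> only if
    \<open>l = m\<close>; then \<open>Y\<close> is empty and \<open>\<beta> u = m\<close> as
    well.\<close>
  have lm: "l < m \<or> Y = {}"
    using assms(5,6) by (metis Min_le equals0I finite_insert insert_iff l_def order_le_less_trans)
  show "inj_on (exchange l \<beta>) (choices m X)"
  proof (rule inj_onI)
    fix x x'
    assume "x \<in> choices m X" "x' \<in> choices m X" and "exchange l \<beta> x = exchange l \<beta> x'"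
    moreover obtain u c u' c' where x: "x = (u, c)" and x': "x' = (u', c')"
      by (metis surj_pair)
    ultimately have uc: "(u, c) \<in> choices m X" "(u', c') \<in> choices m X"
      and eq: "exchange l \<beta> (u, c) = exchange l \<beta> (u', c')"
      by simp_all
    then have u: "u = u'" using inj by (auto simp: exchange_def choices_def)
    have "c = c'"
    proof (rule option.inj_map_strong)
      let ?f = "\<lambda>j. transpose l (\<beta> u) (\<beta> j)"
      show "map_option ?f c = map_option ?f c'" using eq u by (simp add: exchange_def)
      fix j j' assume j: "j \<in> set_option c" "j' \<in> set_option c'" and "?f j = ?f j'"
      then have "\<beta> j = \<beta> j'" using inj_transpose by (metis injD)
      moreover have "j \<in> insert m X" "j' \<in> insert m X"
        using j uc by (auto simp: choices_def)
      ultimately show "j = j'" using inj by blast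
    qed
    with u show "x = x'" by (simp add: x x')
  qed
  show "exchange l \<beta> (u, c) \<in> choices m Y" if uc: "(u, c) \<in> choices m X"
  proof -
    have u: "u \<in> insert m X" using uc by (simp add: choices_def)
    have "transpose l (\<beta> u) (\<beta> j) \<in> insert m Y"
      "transpose l (\<beta> u) (\<beta> j) = m \<longrightarrow> \<beta> u = m" if "c = Some j" for j
    proof -
      have j: "j \<in> insert m X" "j = m \<longrightarrow> u = m" using uc that by (auto simp: choices_def)
      show "transpose l (\<beta> u) (\<beta> j) \<in> insert m Y"
        using into[OF u] into[OF j(1)] l(1) by (auto simp: transpose_def)
      show "transpose l (\<beta> u) (\<beta> j) = m \<longrightarrow> \<beta> u = m"
        using inj[OF j(1), of m] inj[OF u, of m] j(2) \<beta>(2) lm into[OF u] l(1)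
        by (auto simp: transpose_def split: if_splits)
    qed
    then show ?thesis using into[OF u] by (auto simp: exchange_def choices_def)
  qed
  assume uc: "(u, c) \<in> choices m X" and ex: "exchange l \<beta> (u, c) = (v, d)"
  then have v: "v = \<beta> u" and d: "d = map_option (\<lambda>j. transpose l (\<beta> u) (\<beta> j)) c"
    by (auto simp: exchange_def)
  have u: "u \<in> insert m X" using uc by (simp add: choices_def)
  have j: "j \<in> insert m X" if "c = Some j" for j using uc that by (simp add: choices_def)
  have "d = Some v \<longleftrightarrow> c = Some (Min (insert m X))" "d = Some l \<longleftrightarrow> c = Some u"
    using inj[OF j u] inj[OF j l(3)] l(2) by (auto simp: d v transpose_eq_iff)
  moreover have "v = m \<longleftrightarrow> u = m" using inj[OF u, of m] \<beta>(2) v by simp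
  moreover have "d = None \<longleftrightarrow> c = None" by (simp add: d)
  ultimately show "(v = m \<longleftrightarrow> u = m) \<and> (d = None \<longleftrightarrow> c = None) \<and>
      (d = Some v \<longleftrightarrow> c = Some (Min (insert m X))) \<and> (d = Some l \<longleftrightarrow> c = Some u)" by blast
qed

text \<open>The number of empty rows is carried along for the induction: it makes the empty columns
  of both matrices equinumerous at the next step, and it controls
  \<open>leading_perm_orders\<close>.\<close>

definition exchanged :: "nat \<Rightarrow> matrix01 \<Rightarrow> matrix01 \<Rightarrow> bool" where
  "exchanged n A B \<longleftrightarrow> partial_perm n B \<and> card (empty_rows n B) = card (empty_rows n A) \<and>
     Cyc B = Rlmip A \<and> Rlmip B = Cyc A \<and> Excl B = Excl A \<and>
     leading_perm_orders B = leading_perm_orders A"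

lemma ex_exchanging_injection:
  "\<exists>\<phi>. inj_on \<phi> (Collect (partial_perm n)) \<and> (\<forall>A. partial_perm n A \<longrightarrow> exchanged n A (\<phi> A))"
proof (induction n)
  case 0
  have "exchanged 0 A A" if "partial_perm 0 A" for A
    using statistics_bounded[OF that] that by (simp add: exchanged_def)
  then show ?case by (intro exI[of _ id]) auto
next
  case (Suc n)
  let ?m = "Suc n" and ?E = "\<lambda>(A, uc). extend n A uc"
  let ?least = "\<lambda>A. Min (insert ?m (empty_cols n A))"
  obtain \<phi> where \<phi>: "inj_on \<phi> (Collect (partial_perm n))"
    "\<And>A. partial_perm n A \<Longrightarrow> exchanged n A (\<phi> A)"
    using Suc.IH by blast
  have "\<exists>\<beta>. bij_betw \<beta> (insert ?m (empty_cols n A)) (insert ?m (empty_cols n (\<phi> A))) \<and>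
      \<beta> ?m = ?m \<and> \<beta> (?least A) = ?least (\<phi> A)" if A: "partial_perm n A" for A
  proof (rule ex_bij_betw_Min_last)
    show "card (empty_cols n A) = card (empty_cols n (\<phi> A))"
      using \<phi>(2)[OF A] bij_betw_same_card[OF bij_betw_empty_cols_rows]
      by (simp add: exchanged_def A)
  qed (auto simp: empty_cols_def)
  then obtain \<beta> where \<beta>: "\<And>A. partial_perm n A \<Longrightarrow>
      bij_betw (\<beta> A) (insert ?m (empty_cols n A)) (insert ?m (empty_cols n (\<phi> A))) \<and>
      \<beta> A ?m = ?m \<and> \<beta> A (?least A) = ?least (\<phi> A)" by metis
  have cols: "finite (empty_cols n A)" "\<forall>y\<in>empty_cols n A. y < ?m" for A
    by (auto simp: empty_cols_def)
  \<comment> \<open>On decompositions, the leading block is transformed by the induction hypothesis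
    and the choice by the exchange, with a relabelling \<open>\<beta> A\<close> depending on the
    block.\<close>
  define \<psi> where "\<psi> = (\<lambda>(A, uc). (\<phi> A, exchange (?least (\<phi> A)) (\<beta> A) uc))"
  have \<psi>_into: "\<psi> x \<in> extensions n" if "x \<in> extensions n" for x
  proof -
    obtain A u c where x: "x = (A, u, c)" by (cases x)
    then have A: "partial_perm n A" and uc: "(u, c) \<in> choices ?m (empty_cols n A)"
      using that by (auto simp: extensions_def)
    show ?thesis
      using exchange(2)[OF _ _ _ cols(1) cols(1) cols(2) uc] \<beta>[OF A] \<phi>(2)[OF A]
      by (auto simp: x \<psi>_def extensions_def exchanged_def)
  qed
  have \<psi>_inj: "inj_on \<psi> (extensions n)"
  proof (rule inj_onI)
    fix x x'
    assume "x \<in> extensions n" "x' \<in> extensions n" and "\<psi> x = \<psi> x'"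
    moreover obtain A u c A' u' c' where x: "x = (A, u, c)" and x': "x' = (A', u', c')"
      by (metis prod_cases3)
    ultimately have A: "partial_perm n A" "(u, c) \<in> choices (Suc n) (empty_cols n A)"
      and A': "partial_perm n A'" "(u', c') \<in> choices (Suc n) (empty_cols n A')"
      and eq: "\<psi> (A, u, c) = \<psi> (A', u', c')"
      by (auto simp: extensions_def)
    then have AA: "A = A'" using \<phi>(1) A(1) A'(1) by (auto simp: \<psi>_def inj_on_def)
    have "inj_on (exchange (?least (\<phi> A)) (\<beta> A)) (choices ?m (empty_cols n A))"
      using exchange(1)[OF _ _ _ cols(1) cols(1) cols(2)] \<beta>[OF A(1)] by blast
    then have "(u, c) = (u', c')"
      using eq A(2) A'(2) unfolding \<psi>_def AA by (auto simp del: prod.inject dest: inj_onD)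
    with AA show "x = x'" by (simp add: x x')
  qed
  have exch: "exchanged ?m (?E x) (?E (\<psi> x))" if "x \<in> extensions n" for x
  proof -
    obtain A u c where x: "x = (A, u, c)" by (cases x)
    then have A: "partial_perm n A" and uc: "(u, c) \<in> choices ?m (empty_cols n A)"
      using that by (auto simp: extensions_def)
    obtain v d where vd: "exchange (?least (\<phi> A)) (\<beta> A) (u, c) = (v, d)" by fastforce
    have \<psi>x: "\<psi> (A, u, c) = (\<phi> A, v, d)" by (simp add: \<psi>_def vd)
    have \<phi>A: "partial_perm n (\<phi> A)" and vdc: "(v, d) \<in> choices ?m (empty_cols n (\<phi> A))"
      using \<psi>_into[OF that] \<psi>x x by (auto simp: extensions_def)
    have flags: "v = ?m \<longleftrightarrow> u = ?m" "d = None \<longleftrightarrow> c = None" "d = Some v \<longleftrightarrow> c = Some (?least A)"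
      "d = Some (?least (\<phi> A)) \<longleftrightarrow> c = Some u"
      using exchange(3)[OF _ _ _ cols(1) cols(1) cols(2) uc vd] \<beta>[OF A] by blast+
    note E = A refl uc refl and E' = \<phi>A refl vdc refl
    have old: "card (empty_rows n (\<phi> A)) = card (empty_rows n A)" "Cyc (\<phi> A) = Rlmip A"
      "Rlmip (\<phi> A) = Cyc A" "Excl (\<phi> A) = Excl A"
      "leading_perm_orders (\<phi> A) = leading_perm_orders A"
      using \<phi>(2)[OF A] by (auto simp: exchanged_def)
    have "card (empty_rows ?m (extend n (\<phi> A) (v, d))) = card (empty_rows ?m (extend n A (u, c)))"
      by (simp add: card_empty_rows_extend[OF E] card_empty_rows_extend[OF E'] old flags(1,2))
    then show ?thesis
      using partial_perm_extend[OF E']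
      by (simp add: exchanged_def \<psi>x x statistics_extend[OF E] statistics_extend[OF E'] old flags
          split del: if_split)
  qed
  \<comment> \<open>The new injection decomposes a matrix by \<open>inv\<close>, applies
    \<open>\<psi>\<close>, and reassembles the result.\<close>
  define inv where "inv = the_inv_into (extensions n) ?E"
  have bij: "bij_betw inv (Collect (partial_perm ?m)) (extensions n)"
    unfolding inv_def by (rule bij_betw_the_inv_into[OF bij_betw_extend])
  show ?case
  proof (intro exI conjI allI impI)
    show "inj_on (?E \<circ> \<psi> \<circ> inv) (Collect (partial_perm ?m))"
      using bij \<psi>_inj \<psi>_into bij_betw_extend[of n]
      by (intro comp_inj_on) (auto simp: bij_betw_def intro: inj_on_subset)
    fix A assume A: "partial_perm ?m A"
    then have "inv A \<in> extensions n" using bij by (auto simp: bij_betw_def)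
    moreover have "?E (inv A) = A"
      unfolding inv_def using bij_betw_extend[of n] A by (intro f_the_inv_into_f_bij_betw) auto
    ultimately show "exchanged ?m A ((?E \<circ> \<psi> \<circ> inv) A)"
      using exch[of "inv A"] by simp
  qed
qed

section \<open>From the exchanging injection to equidistribution\<close>

lemma equidistributed_overI:
  assumes "bij_betw \<phi> P P" "\<And>x. x \<in> P \<Longrightarrow> f (\<phi> x) = g x"
  shows "equidistributed_over P f g"
  unfolding equidistributed_over_def
proof
  fix t
  have "\<phi> ` P = P" using assms(1) by (simp add: bij_betw_def)
  then have "\<phi> ` {x \<in> P. g x = t} = {x \<in> P. f x = t}"
    using assms(2) by (auto simp: image_iff) (metis imageE)
  then have "bij_betw \<phi> {x \<in> P. g x = t} {x \<in> P. f x = t}"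
    using assms(1) unfolding bij_betw_def by (auto intro: inj_on_subset)
  then show "card {x \<in> P. f x = t} = card {x \<in> P. g x = t}"
    using bij_betw_same_card by fastforce
qed

theorem theorem5p4:
  fixes n k :: nat
  shows "equidistributed_over (partial_perms n k)
           (\<lambda>A. (Cyc A, Rlmip A, Excl A, Sfix A, Scyc A))
           (\<lambda>A. (Rlmip A, Cyc A, Excl A, Sfix A, Scyc A)) \<and>
         equidistributed_over (partial_perms n k) Cyc Rlmip \<and>
         equidistributed_over (partial_perms n k)
           (\<lambda>A. (Cyc A, Rlmip A)) (\<lambda>A. (Rlmip A, Cyc A))"
proof -
  obtain \<phi> where \<phi>: "inj_on \<phi> (Collect (partial_perm n))"
    "\<And>A. partial_perm n A \<Longrightarrow> exchanged n A (\<phi> A)"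
    using ex_exchanging_injection by blast
  have P: "A \<in> partial_perms n k \<longleftrightarrow> partial_perm n A \<and> card (empty_rows n A) = k" for A
    using zero_rows_eq[of n A] by (auto simp: partial_perms_def)
  have "inj_on \<phi> (partial_perms n k)" by (rule inj_on_subset[OF \<phi>(1)]) (auto simp: P)
  moreover have "\<phi> ` partial_perms n k \<subseteq> partial_perms n k"
    using \<phi>(2) by (auto simp: P exchanged_def)
  \<comment> \<open>Preserving the number of empty rows keeps \<open>\<phi>\<close> inside the set
    for fixed \<open>k\<close>; finiteness makes this injective self-map onto.\<close>
  ultimately have bij: "bij_betw \<phi> (partial_perms n k) (partial_perms n k)"
    using finite_partial_perms by (simp add: bij_betw_def endo_inj_surj)
  have ex: "exchanged n A (\<phi> A)" "partial_perm n A" if "A \<in> partial_perms n k" for A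
    using that \<phi>(2) P by auto
  have stats: "Cyc (\<phi> A) = Rlmip A" "Rlmip (\<phi> A) = Cyc A" "Excl (\<phi> A) = Excl A"
    "Sfix (\<phi> A) = Sfix A" "Scyc (\<phi> A) = Scyc A" if "A \<in> partial_perms n k" for A
    using ex[OF that] Sfix_eq[of n A] Sfix_eq[of n "\<phi> A"] Scyc_eq[of n A] Scyc_eq[of n "\<phi> A"]
    by (simp_all add: exchanged_def)
  show ?thesis
    by (intro conjI equidistributed_overI[OF bij]) (simp_all add: stats)
qed

end
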